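(* Let $\{\mathbf{W}_j\}_{j\in T_2}\subset \ell^2(\Lambda,\mathbb{C}^S)$, and suppose that for some positive constant $B_0<\infty$, $$\big\|\mathcal{F}(E_{\frac{m}{M}}\mathbf{W}_j)(\xi)\big\|_{\mathbb{C}^S}\le B_0\quad\text{for all } m\in T_1,\ j\in T_2\text{ and a.e. }\xi\in\Omega.$$ Then $\mathcal{G}(\Lambda,T_1,T_2,\mathbf{W}_j)$ is a DVNUG Bessel sequence with Bessel bound $2^{(M+P)}B_0^2 S$.
   Context: Standing setting: $N,M,S\in\mathbb{N}$ (positive integers), $P\in\mathbb{N}\cup\{0\}$, $r$ is an odd integer coprime with $N$ with $1\le r\le 2N-1$, $\Lambda=\{0,\frac{r}{N}\}+2\mathbb{Z}$, $\Omega=[0,\frac12)\cup[\frac N2,\frac{N+1}{2})$, $T_1=\{0,1,\dots,M-1\}$, $T_2=\{0,1,\dots,P\}$. For $\mathbf{X}\in\mathbb{C}^S$, $[\mathbf{X}]_k$ is its $k$-th coordinate and $\|\mathbf{X}\|_{\mathbb{C}^S}=(\sum_{k=1}^S|[\mathbf{X}]_k|^2)^{1/2}$. $\ell^2(\Lambda,\mathbb{C}^S)$ is the Hilbert space of families $\mathbf{Z}=\{\mathbf{Z}(\lambda)\}_{\lambda\in\Lambda}\subset\mathbb{C}^S$ with $\sum_{\lambda\in\Lambda}\sum_{k=1}^S|[\mathbf{Z}(\lambda)]_k|^2<\infty$, with inner product $\langle\mathbf{Z},\mathbf{W}\rangle=\sum_{\lambda\in\Lambda}\sum_{k=1}^S[\mathbf{Z}(\lambda)]_k\overline{[\mathbf{W}(\lambda)]_k}$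 and induced norm $\|\cdot\|_{\ell^2}$. Operators on $\ell^2(\Lambda,\mathbb{C}^S)$: for $\lambda\in\Lambda$, $(R_{2N\lambda}\mathbf{Z})(\lambda')=\mathbf{Z}(\lambda'-2N\lambda)$, $\lambda'\in\Lambda$ (well defined since $2N\Lambda\subset 2\mathbb{Z}$); for $m\in T_1$, $(E_{\frac mM}\mathbf{Z})(\lambda')=e^{2\pi i\frac mM\lambda'}\mathbf{Z}(\lambda')$, $\lambda'\in\Lambda$. Fourier transform: $\mathcal{F}:\ell^2(\Lambda,\mathbb{C}^S)\to L^2(\Omega,\mathbb{C}^S)$, $[\mathcal{F}(\mathbf{Z})(\xi)]_k=\sum_{\lambda\in\Lambda}[\mathbf{Z}(\lambda)]_k e^{2\pi i\lambda\xi}$, $1\le k\le S$ (series convergent in $L^2(\Omega)$). $\mathcal{G}(\Lambda,T_1,T_2,\mathbf{W}_j)$ denotes the collection $\{E_{\frac mM}R_{2N\lambda}\mathbf{W}_j:\lambda\in\Lambda,\,m\in T_1,\,j\in T_2\}$ (the discrete vector-valued nonuniform Gabor system, DVNUG system, with window sequences $\mathbf{W}_j$). It is a DVNUG Bessel sequence with Bessel bound $\beta$ ($0<\beta<\infty$) if $\sum_{m\in T_1,\,j\in T_2,\,\lambda\in\Lambda}|\langle\mathbf{Z},E_{\frac mM}R_{2N\lambda}\mathbf{W}_j\rangle|^2\le\beta\|\mathbf{Z}\|_{\ell^2}^2$ for all $\mathbf{Z}\in\ell^2(\Lambda,\mathbb{C}^S)$. *)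

theory Defs
  imports "HOL-Analysis.Analysis"
begin

definition spec_set :: "nat \<Rightarrow> nat \<Rightarrow> real set" where
  "spec_set N r = {x + 2 * real_of_int n | x n. x \<in> {0, real r / real N}}"

definition Omega_set :: "nat \<Rightarrow> real set" where
  "Omega_set N = {0..<1/2} \<union> {real N / 2..<(real N + 1) / 2}"

text \<open>
  A family indexed by a set \<open>L\<close> of reals is represented by a total function on the reals whose
  values outside \<open>L\<close> are irrelevant: all notions below only look at values on \<open>L\<close>. In particular,
  for \<open>L = spec_set N r\<close> a translation by \<open>2 * N * l\<close> with \<open>l \<in> L\<close> (an even integer) maps \<open>L\<close>
  onto itself.
\<close>

definition ell2 :: "real set \<Rightarrow> (real \<Rightarrow> complex ^ 's) set" where
  "ell2 L = {Z. (\<lambda>l. \<Sum>k\<in>UNIV. (cmod (Z l $ k))\<^sup>2) summable_on L}"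

definition ell2_inner :: "real set \<Rightarrow> (real \<Rightarrow> complex ^ 's) \<Rightarrow> (real \<Rightarrow> complex ^ 's) \<Rightarrow> complex" where
  "ell2_inner L Z W = (\<Sum>\<^sub>\<infinity>l\<in>L. \<Sum>k\<in>UNIV. Z l $ k * cnj (W l $ k))"

definition ell2_norm :: "real set \<Rightarrow> (real \<Rightarrow> complex ^ 's) \<Rightarrow> real" where
  "ell2_norm L Z = sqrt (Re (ell2_inner L Z Z))"

definition translation :: "real \<Rightarrow> (real \<Rightarrow> complex ^ 's) \<Rightarrow> real \<Rightarrow> complex ^ 's" where
  "translation a Z = (\<lambda>l. Z (l - a))"

definition modulation :: "real \<Rightarrow> (real \<Rightarrow> complex ^ 's) \<Rightarrow> real \<Rightarrow> complex ^ 's" where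
  "modulation b Z = (\<lambda>l. exp (2 * pi * \<i> * b * l) *s Z l)"

definition L2_space :: "real set \<Rightarrow> (real \<Rightarrow> complex ^ 's) set" where
  "L2_space A = {f. f \<in> borel_measurable (lebesgue_on A) \<and>
                    integrable (lebesgue_on A) (\<lambda>\<xi>. (norm (f \<xi>))\<^sup>2)}"

text \<open>
  The series defining the Fourier transform converges in the \<open>L\<^sup>2\<close> sense, unconditionally,
  that is along the net of finite subsets of the index set.
\<close>

definition has_fourier_transform ::
    "real set \<Rightarrow> real set \<Rightarrow> (real \<Rightarrow> complex ^ 's) \<Rightarrow> (real \<Rightarrow> complex ^ 's) \<Rightarrow> bool" where
  "has_fourier_transform L A Z f \<longleftrightarrow>
     f \<in> L2_space A \<and>
     ((\<lambda>F. \<integral>\<xi>. (norm (f \<xi> - (\<Sum>l\<in>F. exp (2 * pi * \<i> * l * \<xi>) *s Z l)))\<^sup>2 \<partial>lebesgue_on A)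
        \<longlongrightarrow> 0) (finite_subsets_at_top L)"

text \<open>
  A representative of the \<open>L\<^sup>2\<close> class of the Fourier transform; two \<open>L\<^sup>2\<close> limits agree almost
  everywhere, so statements up to null sets do not depend on the choice.
\<close>

definition fourier_transform ::
    "real set \<Rightarrow> real set \<Rightarrow> (real \<Rightarrow> complex ^ 's) \<Rightarrow> real \<Rightarrow> complex ^ 's" where
  "fourier_transform L A Z = (SOME f. has_fourier_transform L A Z f)"

definition gabor_system ::
    "nat \<Rightarrow> nat \<Rightarrow> (nat \<Rightarrow> real \<Rightarrow> complex ^ 's) \<Rightarrow> nat \<times> nat \<times> real \<Rightarrow> real \<Rightarrow> complex ^ 's" where
  "gabor_system N M W = (\<lambda>(m, j, l).
     modulation (real m / real M) (translation (2 * real N * l) (W j)))"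

text \<open>
  Summability is demanded explicitly because \<open>infsum\<close> is \<open>0\<close> on families that are not summable.
\<close>

definition Bessel_sequence ::
    "real set \<Rightarrow> 'i set \<Rightarrow> ('i \<Rightarrow> real \<Rightarrow> complex ^ 's) \<Rightarrow> real \<Rightarrow> bool" where
  "Bessel_sequence L I G \<beta> \<longleftrightarrow>
     0 < \<beta> \<and>
     (\<forall>Z\<in>ell2 L.
        (\<lambda>i. (cmod (ell2_inner L Z (G i)))\<^sup>2) summable_on I \<and>
        (\<Sum>\<^sub>\<infinity>i\<in>I. (cmod (ell2_inner L Z (G i)))\<^sup>2) \<le> \<beta> * (ell2_norm L Z)\<^sup>2)"

definition DVNUG_Bessel_sequence ::
    "nat \<Rightarrow> nat \<Rightarrow> nat \<Rightarrow> nat \<Rightarrow> (nat \<Rightarrow> real \<Rightarrow> complex ^ 's) \<Rightarrow> real \<Rightarrow> bool" where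
  "DVNUG_Bessel_sequence N r M P W \<beta> \<longleftrightarrow>
     Bessel_sequence (spec_set N r) ({0..<M} \<times> {0..P} \<times> spec_set N r) (gabor_system N M W) \<beta>"

end

theory Submission
  imports Defs
begin

text \<open>
  Write \<open>G\<close> for the Fourier transform of \<open>E\<^bsub>m/M\<^esub> W\<^sub>j\<close>. Translation by the even integer \<open>2 N \<lambda>\<close> multiplies
  the Fourier transform by an exponential of even frequency, and exponentials of distinct even
  frequencies are orthonormal on \<open>\<Omega>\<close>, just like those with frequencies in \<open>\<Lambda>\<close>. Hence a finite
  combination \<open>Y = \<Sum> c\<^sub>\<lambda> E\<^bsub>m/M\<^esub> R\<^bsub>2N\<lambda>\<^esub> W\<^sub>j\<close> has Fourier transform \<open>p G\<close> with
  \<open>\<integral> |p|\<^sup>2 = \<Sum> |c\<^sub>\<lambda>|\<^sup>2\<close>, so that \<open>\<parallel>Y\<parallel>\<^sup>2 \<le> B\<^sub>0\<^sup>2 \<Sum> |c\<^sub>\<lambda>|\<^sup>2\<close>. Duality turns this synthesis bound into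
  the Bessel bound \<open>B\<^sub>0\<^sup>2\<close> for each pair \<open>(m, j)\<close>, and there are \<open>M (P + 1) \<le> 2\<^bsup>M+P\<^esup>\<close> such pairs.
  Since the Fourier transform is an arbitrary choice when the defining series has no limit, its
  existence must be established as well; this is the argument of Riesz and Fischer.
\<close>

section \<open>Orthonormal exponentials\<close>

definition character :: "real \<Rightarrow> real \<Rightarrow> complex" where
  "character a x = exp (2 * pi * \<i> * a * x)"

lemma character_eq_cis: "character a x = cis (2 * pi * a * x)"
  by (simp add: character_def cis_conv_exp mult_ac)

lemma norm_character [simp]: "cmod (character a x) = 1"
  by (simp add: character_eq_cis)

lemma cnj_character: "cnj (character a x) = character (- a) x"
  by (simp add: character_eq_cis cis_cnj)

lemma character_add: "character (a + b) x = character a x * character b x"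
  by (simp add: character_eq_cis cis_mult algebra_simps)

lemma character_add_right: "character a (x + y) = character a x * character a y"
  by (simp add: character_eq_cis cis_mult algebra_simps)

lemma character_0_right [simp]: "character a 0 = 1"
  by (simp add: character_eq_cis)

lemma character_0 [simp]: "character 0 x = 1"
  by (simp add: character_eq_cis)

lemma borel_measurable_character [measurable]:
  "character a \<in> borel_measurable (lebesgue_on A)"
proof -
  have "character a \<in> borel_measurable borel"
    unfolding character_def by measurable
  then show ?thesis
    by (simp add: measurable_completion measurable_restrict_space1)
qed

text \<open>\<open>character (a - b)\<close> is the product of \<open>character a\<close> with the
  conjugate of \<open>character b\<close>, so its integral is their L2 inner product. The frequency
  set is a parameter because two systems are used on the same domain: the spectrum itself and the
  even frequencies produced by the translations.\<close>

definition orthonormal_exponentials :: "real set \<Rightarrow> real set \<Rightarrow> bool" where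
  "orthonormal_exponentials L A \<longleftrightarrow> A \<in> lmeasurable \<and>
     (\<forall>a\<in>L. \<forall>b\<in>L. (\<integral>\<xi>. character (a - b) \<xi> \<partial>lebesgue_on A) = of_bool (a = b))"

lemma integrable_character:
  assumes "A \<in> lmeasurable"
  shows "integrable (lebesgue_on A) (character a)"
proof -
  interpret finite_measure "lebesgue_on A"
    using assms by (rule finite_measure_lebesgue_on)
  show ?thesis
    by (rule integrable_const_bound[where B = 1]) auto
qed

text \<open>The two intervals of length 1/2 differ by the shift \<open>N / 2\<close>, so integrating
  the exponential gives the product of \<open>character a (1/2) - 1\<close> and
  \<open>1 + character a (N / 2)\<close>, divided by \<open>2 * pi * \<i> * a\<close>. Each
  alternative of the hypothesis makes one factor vanish.\<close>

lemma integral_character_Omega: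
  assumes "a \<noteq> 0" and "character a (1/2) = 1 \<or> character a (real N / 2) = - 1" and "N \<ge> 1"
  shows "(\<integral>\<xi>. character a \<xi> \<partial>lebesgue_on (Omega_set N)) = 0"
proof -
  define h where "h x = character a x / (2 * pi * \<i> * a)" for x
  have deriv: "(h has_vector_derivative character a x) (at x within X)" for x X
    unfolding h_def character_def using assms(1)
    by (auto intro!: derivative_eq_intros has_vector_derivative_real_field simp: field_simps)
  have half_open: "(character a has_integral h (u + 1/2) - h u) {u..<u + 1/2}" for u
  proof -
    \<comment> \<open>The fundamental theorem is applied on the closed interval; the removed right
      endpoint is a null set.\<close>
    have "(character a has_integral h (u + 1/2) - h u) {u..u + 1/2}"
      by (intro fundamental_theorem_of_calculus deriv) auto
    then show ?thesis
      by (rule has_integral_spike_set_eq[THEN iffD1, rotated 2])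
        (auto intro: negligible_subset[of "{u + 1/2}"])
  qed
  have disj: "{0..<1/2} \<inter> {real N / 2..<(real N + 1) / 2} = {}"
    using assms(3) by auto
  have "(character a has_integral (h (1/2) - h 0) + (h (real N / 2 + 1/2) - h (real N / 2))) (Omega_set N)"
    unfolding Omega_set_def using half_open[of 0] half_open[of "real N / 2"] disj
    by (intro has_integral_Un) (auto simp: add_divide_distrib)
  moreover have "(h (1/2) - h 0) + (h (real N / 2 + 1/2) - h (real N / 2)) =
      (character a (1/2) - 1) * (1 + character a (real N / 2)) / (2 * pi * \<i> * a)"
    by (simp add: h_def character_add_right algebra_simps add_divide_distrib diff_divide_distrib)
  ultimately have "(character a has_integral 0) (Omega_set N)"
    using assms(2) by auto
  moreover have "Omega_set N \<in> lmeasurable"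
    unfolding Omega_set_def by (auto intro!: fmeasurable.Un bounded_set_imp_lmeasurable)
  ultimately show ?thesis
    by (metis integrable_character lebesgue_integral_eq_integral integral_unique fmeasurableD)
qed

text \<open>The squared modulus expands into a double sum of exponentials with frequencies
  \<open>l - l'\<close>, and integration leaves only its diagonal.\<close>

lemma pythagoras_scalar:
  fixes c :: "real \<Rightarrow> complex"
  assumes L: "orthonormal_exponentials L A" and F: "finite F" "F \<subseteq> L"
  shows "integrable (lebesgue_on A) (\<lambda>\<xi>. (cmod (\<Sum>l\<in>F. character l \<xi> * c l))\<^sup>2)"
    and "(\<integral>\<xi>. (cmod (\<Sum>l\<in>F. character l \<xi> * c l))\<^sup>2 \<partial>lebesgue_on A) = (\<Sum>l\<in>F. (cmod (c l))\<^sup>2)"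
proof -
  have A: "A \<in> lmeasurable" using L by (simp add: orthonormal_exponentials_def)
  define g where "g \<xi> = (\<Sum>l\<in>F. \<Sum>l'\<in>F. character (l - l') \<xi> * (c l * cnj (c l')))" for \<xi>
  have g: "integrable (lebesgue_on A) g"
    unfolding g_def by (intro Bochner_Integration.integrable_sum integrable_mult_left integrable_character A)
  have gsq: "complex_of_real ((cmod (\<Sum>l\<in>F. character l \<xi> * c l))\<^sup>2) = g \<xi>" for \<xi>
    unfolding complex_norm_square cnj_sum complex_cnj_mult sum_product g_def cnj_character
    by (intro sum.cong refl) (simp add: character_add[of _ "- _", simplified] mult_ac)
  then have eq: "(\<lambda>\<xi>. (cmod (\<Sum>l\<in>F. character l \<xi> * c l))\<^sup>2) = (\<lambda>\<xi>. Re (g \<xi>))"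
    by (metis Re_complex_of_real)
  show "integrable (lebesgue_on A) (\<lambda>\<xi>. (cmod (\<Sum>l\<in>F. character l \<xi> * c l))\<^sup>2)"
    unfolding eq using g by simp
  have "(\<integral>\<xi>. g \<xi> \<partial>lebesgue_on A) = (\<Sum>l\<in>F. \<Sum>l'\<in>F. (\<integral>\<xi>. character (l - l') \<xi> \<partial>lebesgue_on A) * (c l * cnj (c l')))"
    unfolding g_def by (simp add: Bochner_Integration.integral_sum integrable_character A)
  also have "\<dots> = (\<Sum>l\<in>F. \<Sum>l'\<in>F. of_bool (l = l') * (c l * cnj (c l')))"
    using L F unfolding orthonormal_exponentials_def
    by (intro sum.cong refl arg_cong2[where f = "(*)"]) blast
  also have "\<dots> = (\<Sum>l\<in>F. complex_of_real ((cmod (c l))\<^sup>2))"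
    using F by (simp add: complex_norm_square del: of_real_power)
  finally have "Re (\<integral>\<xi>. g \<xi> \<partial>lebesgue_on A) = (\<Sum>l\<in>F. (cmod (c l))\<^sup>2)"
    by simp
  then show "(\<integral>\<xi>. (cmod (\<Sum>l\<in>F. character l \<xi> * c l))\<^sup>2 \<partial>lebesgue_on A) = (\<Sum>l\<in>F. (cmod (c l))\<^sup>2)"
    unfolding eq using g by simp
qed

section \<open>Vector-valued trigonometric polynomials\<close>

lemma norm_vec_square: "(norm (v :: complex ^ 's))\<^sup>2 = (\<Sum>k\<in>UNIV. (cmod (v $ k))\<^sup>2)"
  by (simp add: norm_vec_def L2_set_def sum_nonneg)

definition trig_poly :: "(real \<Rightarrow> complex ^ 's) \<Rightarrow> real set \<Rightarrow> real \<Rightarrow> complex ^ 's" where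
  "trig_poly Z F \<xi> = (\<Sum>l\<in>F. character l \<xi> *s Z l)"

lemma trig_poly_nth: "trig_poly Z F \<xi> $ k = (\<Sum>l\<in>F. character l \<xi> * Z l $ k)"
  by (simp add: trig_poly_def)

lemma borel_measurable_vec_complex:
  fixes f :: "'a \<Rightarrow> complex ^ 's"
  assumes "\<And>k. (\<lambda>x. f x $ k) \<in> borel_measurable M"
  shows "f \<in> borel_measurable M"
  unfolding borel_measurable_euclidean_space[of f]
proof
  fix i :: "complex ^ 's" assume "i \<in> Basis"
  then obtain k u where "i = axis k u" by (auto simp: Basis_vec_def)
  then show "(\<lambda>x. f x \<bullet> i) \<in> borel_measurable M"
    using assms[of k] by (simp add: inner_axis)
qed

lemma borel_measurable_trig_poly [measurable]:
  "trig_poly Z F \<in> borel_measurable (lebesgue_on A)"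
  by (rule borel_measurable_vec_complex) (simp add: trig_poly_nth)

lemma pythagoras:
  assumes "orthonormal_exponentials L A" and "finite F" "F \<subseteq> L"
  shows "integrable (lebesgue_on A) (\<lambda>\<xi>. (norm (trig_poly Z F \<xi>))\<^sup>2)"
    and "(\<integral>\<xi>. (norm (trig_poly Z F \<xi>))\<^sup>2 \<partial>lebesgue_on A) = (\<Sum>l\<in>F. (norm (Z l))\<^sup>2)"
proof -
  show "integrable (lebesgue_on A) (\<lambda>\<xi>. (norm (trig_poly Z F \<xi>))\<^sup>2)"
    unfolding norm_vec_square trig_poly_nth
    by (intro Bochner_Integration.integrable_sum pythagoras_scalar[OF assms])
  have "(\<integral>\<xi>. (norm (trig_poly Z F \<xi>))\<^sup>2 \<partial>lebesgue_on A) = (\<Sum>k\<in>UNIV. \<Sum>l\<in>F. (cmod (Z l $ k))\<^sup>2)"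
    unfolding norm_vec_square trig_poly_nth
    by (simp add: Bochner_Integration.integral_sum pythagoras_scalar[OF assms])
  also have "\<dots> = (\<Sum>l\<in>F. (norm (Z l))\<^sup>2)"
    unfolding norm_vec_square by (rule sum.swap)
  finally show "(\<integral>\<xi>. (norm (trig_poly Z F \<xi>))\<^sup>2 \<partial>lebesgue_on A) = (\<Sum>l\<in>F. (norm (Z l))\<^sup>2)" .
qed

section \<open>Existence and linearity of the Fourier transform\<close>

text \<open>The inequality \<open>d <= (1/2)^n + 2^n * d^2\<close> turns the bound
  \<open>(1/4)^n\<close> on squared increments into an L1 bound of order \<open>(1/2)^n\<close>,
  because the measure is finite. The series of increments then has a finite integral, hence is
  finite almost everywhere, and telescoping gives the limit. This is the pointwise half of the
  Riesz-Fischer argument.\<close>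

lemma AE_convergent_if_summable_L2_increments:
  fixes f :: "nat \<Rightarrow> 'a \<Rightarrow> 'b::{banach,second_countable_topology}"
  assumes "finite_measure M"
    and meas [measurable]: "\<And>n. f n \<in> borel_measurable M"
    and int: "\<And>n. integrable M (\<lambda>x. (norm (f (Suc n) x - f n x))\<^sup>2)"
    and le: "\<And>n. (\<integral>x. (norm (f (Suc n) x - f n x))\<^sup>2 \<partial>M) \<le> (1/4) ^ n"
  shows "AE x in M. convergent (\<lambda>n. f n x)"
proof -
  interpret finite_measure M by fact
  define d where "d n x = norm (f (Suc n) x - f n x)" for n x
  have [measurable]: "d n \<in> borel_measurable M" for n unfolding d_def by measurable
  have d0: "d n x \<ge> 0" for n x by (simp add: d_def)
  have amgm: "d n x \<le> (1/2)^n + 2^n * (d n x)\<^sup>2" for n x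
  proof -
    have "2 * (1 * (2^n * d n x)) \<le> 1 + (2^n * d n x)\<^sup>2"
      using sum_squares_bound[of 1 "2^n * d n x"] by simp
    then have "2^n * d n x \<le> 1 + (2^n * d n x)\<^sup>2" using d0[of n x]
      by (smt (verit) zero_le_power mult_nonneg_nonneg)
    then have "(1/2)^n * (2^n * d n x) \<le> (1/2)^n * (1 + (2^n * d n x)\<^sup>2)"
      by (intro mult_left_mono) auto
    then show ?thesis by (simp add: power_divide field_simps power2_eq_square)
  qed
  have int1: "integrable M (\<lambda>x. (1/2)^n + 2^n * (d n x)\<^sup>2)" for n
    using int[of n] by (simp add: d_def)
  have nn: "(\<integral>\<^sup>+x. ennreal (d n x) \<partial>M) \<le> ennreal ((1/2)^n * (measure M (space M) + 1))" for n
  proof -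
    have "(\<integral>\<^sup>+x. ennreal (d n x) \<partial>M) \<le> (\<integral>\<^sup>+x. ennreal ((1/2)^n + 2^n * (d n x)\<^sup>2) \<partial>M)"
      by (intro nn_integral_mono ennreal_leI amgm)
    also have "\<dots> = ennreal (\<integral>x. (1/2)^n + 2^n * (d n x)\<^sup>2 \<partial>M)"
      by (rule nn_integral_eq_integral[OF int1]) auto
    also have "(\<integral>x. (1/2)^n + 2^n * (d n x)\<^sup>2 \<partial>M) = (1/2)^n * measure M (space M) + 2^n * (\<integral>x. (d n x)\<^sup>2 \<partial>M)"
      using int[of n] by (simp add: d_def)
    also have "ennreal \<dots> \<le> ennreal ((1/2)^n * measure M (space M) + 2^n * (1/4)^n)"
      using le[of n] by (intro ennreal_leI add_left_mono mult_left_mono) (auto simp: d_def)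
    also have "(2::real)^n * (1/4)^n = (1/2)^n"
      by (simp flip: power_mult_distrib)
    finally show ?thesis by (simp add: algebra_simps)
  qed
  have "(\<integral>\<^sup>+x. (\<Sum>n. ennreal (d n x)) \<partial>M) = (\<Sum>n. \<integral>\<^sup>+x. ennreal (d n x) \<partial>M)"
    by (rule nn_integral_suminf) simp
  also have "\<dots> \<le> (\<Sum>n. ennreal ((1/2)^n * (measure M (space M) + 1)))"
    by (intro suminf_le nn) auto
  also have "\<dots> = ennreal (\<Sum>n. (1/2)^n * (measure M (space M) + 1))"
    by (intro suminf_ennreal2 summable_mult2 summable_geometric) auto
  finally have "(\<integral>\<^sup>+x. (\<Sum>n. ennreal (d n x)) \<partial>M) \<noteq> \<infinity>"
    by (metis ennreal_neq_top infinity_ennreal_def neq_top_trans)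
  then have "AE x in M. (\<Sum>n. ennreal (d n x)) \<noteq> \<infinity>"
    by (intro nn_integral_PInf_AE) auto
  then show ?thesis
  proof eventually_elim
    case (elim x)
    then have "summable (\<lambda>n. d n x)"
      by (intro summable_suminf_not_top) (auto simp: d0)
    then have "summable (\<lambda>n. f (Suc n) x - f n x)"
      unfolding d_def by (rule summable_norm_cancel)
    then have "convergent (\<lambda>n. \<Sum>i<n. f (Suc i) x - f i x)"
      by (simp add: summable_iff_convergent)
    then have "convergent (\<lambda>n. f n x - f 0 x)"
      using sum_lessThan_telescope[of "\<lambda>n. f n x"] by simp
    then show ?case
      by (simp add: convergent_diff_const_right_iff)
  qed
qed

text \<open>A weighted replacement for the triangle inequality that stays with squares. The choice
  \<open>t = 1\<close> suffices for closure and convergence arguments; letting \<open>t\<close> tend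
  to 0 keeps the constant 1 in front of the main term.\<close>

lemma norm_add_square_le:
  fixes a b :: "'a::real_normed_vector"
  assumes "t > 0"
  shows "(norm (a + b))\<^sup>2 \<le> (1 + t) * (norm a)\<^sup>2 + (1 + 1/t) * (norm b)\<^sup>2"
proof -
  have "(norm (a + b))\<^sup>2 \<le> (norm a + norm b)\<^sup>2"
    by (simp add: norm_triangle_ineq)
  moreover have "0 \<le> (t * norm a - norm b)\<^sup>2 / t"
    using assms by simp
  then have "2 * norm a * norm b \<le> t * (norm a)\<^sup>2 + (norm b)\<^sup>2 / t"
    using assms by (simp add: power2_eq_square field_simps)
  ultimately show ?thesis
    by (simp add: power2_eq_square algebra_simps)
qed

section \<open>Closure properties of square-integrable functions\<close>

lemma norm_vector_scalar_mult: "norm (c *s (v :: complex ^ 's)) = cmod c * norm v"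
proof (rule power2_eq_imp_eq)
  show "(norm (c *s v))\<^sup>2 = (cmod c * norm v)\<^sup>2"
    by (simp add: norm_vec_square norm_mult power_mult_distrib sum_distrib_left)
qed simp_all

lemma borel_measurable_scalar_mult:
  fixes f :: "'a \<Rightarrow> complex ^ 's"
  assumes u: "u \<in> borel_measurable M" and f: "f \<in> borel_measurable M"
  shows "(\<lambda>x. u x *s f x) \<in> borel_measurable M"
proof (rule borel_measurable_vec_complex)
  fix k
  have "(\<lambda>x. f x $ k) \<in> borel_measurable M"
    using f by (rule measurable_compose)
      (intro borel_measurable_continuous_onI linear_continuous_on bounded_linear_vec_nth)
  then show "(\<lambda>x. (u x *s f x) $ k) \<in> borel_measurable M"
    using u by simp
qed

lemma L2_space_add:
  fixes f g :: "real \<Rightarrow> complex ^ 's"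
  assumes f: "f \<in> L2_space A" and g: "g \<in> L2_space A"
  shows "(\<lambda>\<xi>. f \<xi> + g \<xi>) \<in> L2_space A"
proof -
  have [measurable]: "f \<in> borel_measurable (lebesgue_on A)" "g \<in> borel_measurable (lebesgue_on A)"
    using f g by (auto simp: L2_space_def)
  have "integrable (lebesgue_on A) (\<lambda>\<xi>. 2 * (norm (f \<xi>))\<^sup>2 + 2 * (norm (g \<xi>))\<^sup>2)"
    using f g by (auto simp: L2_space_def)
  then have "integrable (lebesgue_on A) (\<lambda>\<xi>. (norm (f \<xi> + g \<xi>))\<^sup>2)"
    by (rule Bochner_Integration.integrable_bound)
      (use norm_add_square_le[of 1] in \<open>auto intro!: AE_I2\<close>)
  then show ?thesis by (simp add: L2_space_def)
qed

lemma L2_space_scalar_mult: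
  assumes "u \<in> borel_measurable (lebesgue_on A)" "\<And>\<xi>. cmod (u \<xi>) \<le> C" "f \<in> L2_space A"
  shows "(\<lambda>\<xi>. u \<xi> *s f \<xi>) \<in> L2_space A"
proof -
  have f: "f \<in> borel_measurable (lebesgue_on A)" "integrable (lebesgue_on A) (\<lambda>\<xi>. C\<^sup>2 * (norm (f \<xi>))\<^sup>2)"
    using assms by (auto simp: L2_space_def)
  have m: "(\<lambda>\<xi>. u \<xi> *s f \<xi>) \<in> borel_measurable (lebesgue_on A)"
    by (intro borel_measurable_scalar_mult assms f)
  have "(norm (u \<xi> *s f \<xi>))\<^sup>2 \<le> C\<^sup>2 * (norm (f \<xi>))\<^sup>2" for \<xi>
    unfolding norm_vector_scalar_mult power_mult_distrib
    by (intro mult_right_mono power_mono assms) auto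
  then have "integrable (lebesgue_on A) (\<lambda>\<xi>. (norm (u \<xi> *s f \<xi>))\<^sup>2)"
    using m by (intro Bochner_Integration.integrable_bound[OF f(2)]) (auto intro!: AE_I2)
  with m show ?thesis by (simp add: L2_space_def)
qed

lemma L2_space_diff:
  fixes f g :: "real \<Rightarrow> complex ^ 's"
  assumes "f \<in> L2_space A" "g \<in> L2_space A"
  shows "(\<lambda>\<xi>. f \<xi> - g \<xi>) \<in> L2_space A"
  using L2_space_add[OF assms(1) L2_space_scalar_mult[OF _ _ assms(2), of "\<lambda>_. -1" 1]]
  by (simp add: vector_scalar_mult_def minus_vec_def plus_vec_def)

lemma trig_poly_in_L2_space:
  assumes "orthonormal_exponentials L A" "finite F" "F \<subseteq> L"
  shows "trig_poly Z F \<in> L2_space A"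
  using pythagoras(1)[OF assms] by (simp add: L2_space_def)

lemma ell2_iff: "Z \<in> ell2 L \<longleftrightarrow> (\<lambda>l. (norm (Z l))\<^sup>2) summable_on L"
  by (simp add: ell2_def norm_vec_square)

lemma has_fourier_transform_iff:
  "has_fourier_transform L A Z f \<longleftrightarrow> f \<in> L2_space A \<and>
     ((\<lambda>F. \<integral>\<xi>. (norm (f \<xi> - trig_poly Z F \<xi>))\<^sup>2 \<partial>lebesgue_on A) \<longlongrightarrow> 0) (finite_subsets_at_top L)"
  by (simp add: has_fourier_transform_def trig_poly_def character_def)

text \<open>Terms common to \<open>F\<close> and \<open>G\<close> cancel. Flipping the sign of the
  coefficients outside \<open>F\<close> writes what remains as one polynomial over the symmetric
  difference, and the sign does not affect norms.\<close>

lemma pythagoras_diff: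
  assumes L: "orthonormal_exponentials L A" and F: "finite F" "F \<subseteq> L" and G: "finite G" "G \<subseteq> L"
  shows "integrable (lebesgue_on A) (\<lambda>\<xi>. (norm (trig_poly Z F \<xi> - trig_poly Z G \<xi>))\<^sup>2)"
    and "(\<integral>\<xi>. (norm (trig_poly Z F \<xi> - trig_poly Z G \<xi>))\<^sup>2 \<partial>lebesgue_on A)
      = (\<Sum>l\<in>(F - G) \<union> (G - F). (norm (Z l))\<^sup>2)"
proof -
  define Y where "Y l = (if l \<in> F then Z l else - Z l)" for l
  have minus: "c *s (- v) = - (c *s v)" for c and v :: "complex ^ 's"
    by (simp add: vec_eq_iff)
  have eq: "trig_poly Z F \<xi> - trig_poly Z G \<xi> = trig_poly Y ((F - G) \<union> (G - F)) \<xi>" for \<xi>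
  proof -
    have "trig_poly Y ((F - G) \<union> (G - F)) \<xi> = trig_poly Y (F - G) \<xi> + trig_poly Y (G - F) \<xi>"
      unfolding trig_poly_def using F G by (intro sum.union_disjoint) auto
    also have "trig_poly Y (F - G) \<xi> = trig_poly Z (F - G) \<xi>"
      unfolding trig_poly_def by (intro sum.cong) (auto simp: Y_def)
    also have "trig_poly Y (G - F) \<xi> = - trig_poly Z (G - F) \<xi>"
      unfolding trig_poly_def sum_negf[symmetric] by (intro sum.cong) (auto simp: Y_def minus)
    also have "trig_poly Z (F - G) \<xi> + - trig_poly Z (G - F) \<xi> = trig_poly Z F \<xi> - trig_poly Z G \<xi>"
      using sum.Int_Diff[OF F(1), of "\<lambda>l. character l \<xi> *s Z l" G]
        sum.Int_Diff[OF G(1), of "\<lambda>l. character l \<xi> *s Z l" F]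
      by (simp add: trig_poly_def Int_commute)
    finally show ?thesis by simp
  qed
  have FG: "finite ((F - G) \<union> (G - F))" "(F - G) \<union> (G - F) \<subseteq> L" using F G by auto
  show "integrable (lebesgue_on A) (\<lambda>\<xi>. (norm (trig_poly Z F \<xi> - trig_poly Z G \<xi>))\<^sup>2)"
    unfolding eq by (rule pythagoras(1)[OF L FG])
  have "(\<integral>\<xi>. (norm (trig_poly Z F \<xi> - trig_poly Z G \<xi>))\<^sup>2 \<partial>lebesgue_on A)
      = (\<Sum>l\<in>(F - G) \<union> (G - F). (norm (Y l))\<^sup>2)"
    unfolding eq by (rule pythagoras(2)[OF L FG])
  also have "\<dots> = (\<Sum>l\<in>(F - G) \<union> (G - F). (norm (Z l))\<^sup>2)"
    by (intro sum.cong) (auto simp: Y_def)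
  finally show "(\<integral>\<xi>. (norm (trig_poly Z F \<xi> - trig_poly Z G \<xi>))\<^sup>2 \<partial>lebesgue_on A)
      = (\<Sum>l\<in>(F - G) \<union> (G - F). (norm (Z l))\<^sup>2)" .
qed

text \<open>Riesz-Fischer: finite sets are chosen outside which the coefficients carry little mass,
  the partial sums along an increasing sequence of such sets converge almost everywhere, and Fatou's
  lemma shows that the pointwise limit is the L2 limit along the whole net of finite sets.\<close>

lemma has_fourier_transform_exists:
  fixes Z :: "real \<Rightarrow> complex ^ 's"
  assumes L: "orthonormal_exponentials L A" and Z: "Z \<in> ell2 L"
  shows "\<exists>f. has_fourier_transform L A Z f"
proof -
  have A: "A \<in> lmeasurable" using L by (simp add: orthonormal_exponentials_def)
  have sumZ: "(\<lambda>l. (norm (Z l))\<^sup>2) summable_on L" using Z by (simp add: ell2_iff)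
  \<comment> \<open>The rate \<open>(1/4) ^ n\<close> is the one required by the almost-everywhere
    convergence criterion.\<close>
  have "\<exists>F. finite F \<and> F \<subseteq> L \<and>
      (\<forall>G. finite G \<longrightarrow> G \<subseteq> L \<longrightarrow> G \<inter> F = {} \<longrightarrow> (\<Sum>l\<in>G. (norm (Z l))\<^sup>2) \<le> (1/4) ^ n)" for n :: nat
  proof -
    let ?S = "\<Sum>\<^sub>\<infinity>l\<in>L. (norm (Z l))\<^sup>2"
    have "\<exists>F. finite F \<and> F \<subseteq> L \<and> ?S - (1/4)^n < (\<Sum>l\<in>F. (norm (Z l))\<^sup>2)"
    proof (rule ccontr)
      assume "\<not> ?thesis"
      then have "?S \<le> ?S - (1/4)^n"
        by (intro infsum_le_finite_sums[OF sumZ]) (meson not_le)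
      moreover have "(1/4 :: real) ^ n > 0"
        by (rule zero_less_power) simp
      ultimately show False by linarith
    qed
    then obtain F where F: "finite F" "F \<subseteq> L" "?S - (1/4)^n < (\<Sum>l\<in>F. (norm (Z l))\<^sup>2)"
      by blast
    moreover have "(\<Sum>l\<in>G. (norm (Z l))\<^sup>2) \<le> (1/4) ^ n"
      if "finite G" "G \<subseteq> L" "G \<inter> F = {}" for G
    proof -
      have "(\<Sum>l\<in>F \<union> G. (norm (Z l))\<^sup>2) \<le> ?S"
        using F that by (intro finite_sum_le_infsum[OF sumZ]) auto
      moreover have "(\<Sum>l\<in>F \<union> G. (norm (Z l))\<^sup>2) = (\<Sum>l\<in>F. (norm (Z l))\<^sup>2) + (\<Sum>l\<in>G. (norm (Z l))\<^sup>2)"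
        using F that by (intro sum.union_disjoint) auto
      ultimately show ?thesis using F by linarith
    qed
    ultimately show ?thesis by blast
  qed
  then obtain T where T: "\<And>n::nat. finite (T n)" "\<And>n. T n \<subseteq> L"
    and tail: "\<And>n G. finite G \<Longrightarrow> G \<subseteq> L \<Longrightarrow> G \<inter> T n = {} \<Longrightarrow> (\<Sum>l\<in>G. (norm (Z l))\<^sup>2) \<le> (1/4) ^ n"
    by metis
  \<comment> \<open>The union makes the sets increase, so that both \<open>H n\<close> and
    \<open>H (Suc n)\<close> contain \<open>T n\<close>.\<close>
  define H where "H n = (\<Union>i\<le>n. T i)" for n
  have H: "finite (H n)" "H n \<subseteq> L" for n using T by (auto simp: H_def)
  have TH: "T n \<subseteq> H k" if "n \<le> k" for n k using that by (auto simp: H_def)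
  \<comment> \<open>Two finite sets containing \<open>T n\<close> differ only outside
    \<open>T n\<close>, where \<open>tail\<close> applies.\<close>
  have close: "(\<integral>\<xi>. (norm (trig_poly Z F \<xi> - trig_poly Z G \<xi>))\<^sup>2 \<partial>lebesgue_on A) \<le> (1/4) ^ n"
    if "finite F" "F \<subseteq> L" "T n \<subseteq> F" "finite G" "G \<subseteq> L" "T n \<subseteq> G" for F G n
    unfolding pythagoras_diff(2)[OF L that(1,2,4,5)] using that by (intro tail) auto
  have conv: "AE \<xi> in lebesgue_on A. convergent (\<lambda>n. trig_poly Z (H n) \<xi>)"
    using A
    by (intro AE_convergent_if_summable_L2_increments finite_measure_lebesgue_on
        pythagoras_diff[OF L] close H TH borel_measurable_trig_poly) auto
  \<comment> \<open>Where no limit exists, \<open>lim\<close> returns a fixed unspecified value; by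
    \<open>conv\<close> this concerns only a null set.\<close>
  define g where "g \<xi> = lim (\<lambda>n. trig_poly Z (H n) \<xi>)" for \<xi>
  have g [measurable]: "g \<in> borel_measurable (lebesgue_on A)"
    unfolding g_def by measurable
  have nn: "(\<integral>\<^sup>+\<xi>. ennreal ((norm (g \<xi> - trig_poly Z F \<xi>))\<^sup>2) \<partial>lebesgue_on A) \<le> ennreal ((1/4) ^ n)"
    if F: "finite F" "F \<subseteq> L" "T n \<subseteq> F" for F n
  proof -
    let ?u = "\<lambda>k \<xi>. ennreal ((norm (trig_poly Z (H k) \<xi> - trig_poly Z F \<xi>))\<^sup>2)"
    \<comment> \<open>Fatou's lemma passes the estimate \<open>close\<close> to the limit: almost
      everywhere the liminf is the actual limit, and from \<open>k = n\<close> on the set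
      \<open>H k\<close> contains \<open>T n\<close>.\<close>
    have "(\<integral>\<^sup>+\<xi>. ennreal ((norm (g \<xi> - trig_poly Z F \<xi>))\<^sup>2) \<partial>lebesgue_on A)
        = (\<integral>\<^sup>+\<xi>. liminf (\<lambda>k. ?u k \<xi>) \<partial>lebesgue_on A)"
    proof (rule nn_integral_cong_AE, use conv in eventually_elim)
      case (elim \<xi>)
      then have "(\<lambda>k. trig_poly Z (H k) \<xi>) \<longlonglongrightarrow> g \<xi>"
        by (simp add: g_def convergent_LIMSEQ_iff)
      then have "(\<lambda>k. ?u k \<xi>) \<longlonglongrightarrow> ennreal ((norm (g \<xi> - trig_poly Z F \<xi>))\<^sup>2)"
        by (intro tendsto_ennrealI tendsto_intros)
      then show ?case
        by (rule lim_imp_Liminf[OF sequentially_bot, symmetric])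
    qed
    also have "\<dots> \<le> liminf (\<lambda>k. \<integral>\<^sup>+\<xi>. ?u k \<xi> \<partial>lebesgue_on A)"
      by (rule nn_integral_liminf) measurable
    also have "\<dots> \<le> liminf (\<lambda>k. ennreal ((1/4) ^ n))"
    proof (rule Liminf_mono, rule eventually_mono[OF eventually_ge_at_top[of n]])
      fix k assume "n \<le> k"
      have "(\<integral>\<^sup>+\<xi>. ?u k \<xi> \<partial>lebesgue_on A)
          = ennreal (\<integral>\<xi>. (norm (trig_poly Z (H k) \<xi> - trig_poly Z F \<xi>))\<^sup>2 \<partial>lebesgue_on A)"
        by (rule nn_integral_eq_integral[OF pythagoras_diff(1)[OF L H F(1,2)]]) auto
      also have "\<dots> \<le> ennreal ((1/4) ^ n)"
        by (intro ennreal_leI close H TH F \<open>n \<le> k\<close>)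
      finally show "(\<integral>\<^sup>+\<xi>. ?u k \<xi> \<partial>lebesgue_on A) \<le> ennreal ((1/4) ^ n)" .
    qed
    also have "\<dots> = ennreal ((1/4) ^ n)" by (simp add: Liminf_const)
    finally show ?thesis .
  qed
  have int: "integrable (lebesgue_on A) (\<lambda>\<xi>. (norm (g \<xi> - trig_poly Z F \<xi>))\<^sup>2)"
    and le: "(\<integral>\<xi>. (norm (g \<xi> - trig_poly Z F \<xi>))\<^sup>2 \<partial>lebesgue_on A) \<le> (1/4) ^ n"
    if F: "finite F" "F \<subseteq> L" "T n \<subseteq> F" for F n
  proof -
    show *: "integrable (lebesgue_on A) (\<lambda>\<xi>. (norm (g \<xi> - trig_poly Z F \<xi>))\<^sup>2)"
      using nn[OF F] by (intro integrableI_bounded) (auto intro: le_less_trans)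
    have "ennreal (\<integral>\<xi>. (norm (g \<xi> - trig_poly Z F \<xi>))\<^sup>2 \<partial>lebesgue_on A) \<le> ennreal ((1/4) ^ n)"
      using nn[OF F] by (subst nn_integral_eq_integral[OF *, symmetric]) auto
    then show "(\<integral>\<xi>. (norm (g \<xi> - trig_poly Z F \<xi>))\<^sup>2 \<partial>lebesgue_on A) \<le> (1/4) ^ n"
      by (simp add: ennreal_le_iff)
  qed
  \<comment> \<open>Square integrability of \<open>g\<close> is obtained by adding back a single
    polynomial at finite L2 distance from it.\<close>
  have "(\<lambda>\<xi>. g \<xi> - trig_poly Z (T 0) \<xi>) \<in> L2_space A"
    using int[OF T order_refl] by (simp add: L2_space_def)
  from L2_space_add[OF this trig_poly_in_L2_space[where Z = Z, OF L T[of 0]]]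
  have "g \<in> L2_space A" by simp
  moreover have "((\<lambda>F. \<integral>\<xi>. (norm (g \<xi> - trig_poly Z F \<xi>))\<^sup>2 \<partial>lebesgue_on A) \<longlongrightarrow> 0)
      (finite_subsets_at_top L)"
  proof (rule tendstoI)
    fix e :: real assume "e > 0"
    then obtain n where n: "(1/4) ^ n < e"
      using real_arch_pow_inv[of e "1/4"] by auto
    show "\<forall>\<^sub>F F in finite_subsets_at_top L.
        dist (\<integral>\<xi>. (norm (g \<xi> - trig_poly Z F \<xi>))\<^sup>2 \<partial>lebesgue_on A) 0 < e"
      unfolding eventually_finite_subsets_at_top
    proof (intro exI[of _ "T n"] conjI allI impI T)
      fix F assume "finite F \<and> T n \<subseteq> F \<and> F \<subseteq> L"
      then show "dist (\<integral>\<xi>. (norm (g \<xi> - trig_poly Z F \<xi>))\<^sup>2 \<partial>lebesgue_on A) 0 < e"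
        using le[of F n] n by (simp add: dist_real_def)
    qed
  qed
  ultimately show ?thesis by (auto simp: has_fourier_transform_iff)
qed

text \<open>One half of Plancherel's identity. Any finite \<open>G\<close> above \<open>F\<close>
  has at least the mass of \<open>F\<close>, which equals the energy of its partial sum. The
  weighted square inequality compares this energy with that of \<open>f\<close>; the error
  disappears in the limit over \<open>G\<close>, and the factor \<open>1 + t\<close> as
  \<open>t\<close> tends to 0 from the right.\<close>

lemma bessel_fourier_transform:
  assumes L: "orthonormal_exponentials L A" and f: "has_fourier_transform L A Z f"
    and F: "finite F" "F \<subseteq> L"
  shows "(\<Sum>l\<in>F. (norm (Z l))\<^sup>2) \<le> (\<integral>\<xi>. (norm (f \<xi>))\<^sup>2 \<partial>lebesgue_on A)"
proof -
  let ?I = "\<integral>\<xi>. (norm (f \<xi>))\<^sup>2 \<partial>lebesgue_on A"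
  let ?D = "\<lambda>G. \<integral>\<xi>. (norm (f \<xi> - trig_poly Z G \<xi>))\<^sup>2 \<partial>lebesgue_on A"
  have f2: "f \<in> L2_space A" and D: "(?D \<longlongrightarrow> 0) (finite_subsets_at_top L)"
    using f by (auto simp: has_fourier_transform_iff)
  have "(\<Sum>l\<in>F. (norm (Z l))\<^sup>2) \<le> (1 + t) * ?I" if t: "t > 0" for t
  proof (rule tendsto_lowerbound)
    show "((\<lambda>G. (1 + t) * ?I + (1 + 1/t) * ?D G) \<longlongrightarrow> (1 + t) * ?I) (finite_subsets_at_top L)"
      using tendsto_add[OF tendsto_const tendsto_mult_right_zero[OF D]] by simp
    show "\<forall>\<^sub>F G in finite_subsets_at_top L. (\<Sum>l\<in>F. (norm (Z l))\<^sup>2) \<le> (1 + t) * ?I + (1 + 1/t) * ?D G"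
      unfolding eventually_finite_subsets_at_top
    proof (intro exI[of _ F] conjI allI impI F)
      fix G assume G: "finite G \<and> F \<subseteq> G \<and> G \<subseteq> L"
      have G2: "trig_poly Z G \<in> L2_space A" using G by (intro trig_poly_in_L2_space[OF L]) auto
      have "(\<Sum>l\<in>F. (norm (Z l))\<^sup>2) \<le> (\<Sum>l\<in>G. (norm (Z l))\<^sup>2)"
        using G by (intro sum_mono2) auto
      also have "\<dots> = (\<integral>\<xi>. (norm (trig_poly Z G \<xi>))\<^sup>2 \<partial>lebesgue_on A)"
        using G by (intro pythagoras(2)[OF L, symmetric]) auto
      also have "\<dots> \<le> (\<integral>\<xi>. (1 + t) * (norm (f \<xi>))\<^sup>2 + (1 + 1/t) * (norm (f \<xi> - trig_poly Z G \<xi>))\<^sup>2 \<partial>lebesgue_on A)"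
      proof (rule integral_mono)
        show "(norm (trig_poly Z G \<xi>))\<^sup>2 \<le> (1 + t) * (norm (f \<xi>))\<^sup>2 + (1 + 1/t) * (norm (f \<xi> - trig_poly Z G \<xi>))\<^sup>2" for \<xi>
          using norm_add_square_le[OF t, of "f \<xi>" "trig_poly Z G \<xi> - f \<xi>"]
          by (simp add: norm_minus_commute)
      qed (use f2 G2 L2_space_diff[OF f2 G2] in \<open>auto simp: L2_space_def\<close>)
      also have "\<dots> = (1 + t) * ?I + (1 + 1/t) * ?D G"
        using f2 L2_space_diff[OF f2 G2] by (simp add: L2_space_def)
      finally show "(\<Sum>l\<in>F. (norm (Z l))\<^sup>2) \<le> (1 + t) * ?I + (1 + 1/t) * ?D G" .
    qed
  qed simp
  then have "\<forall>\<^sub>F t in at_right 0. (\<Sum>l\<in>F. (norm (Z l))\<^sup>2) \<le> (1 + t) * ?I"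
    by (auto simp: eventually_at_right_field intro: exI[of _ 1])
  moreover have "((\<lambda>t. (1 + t) * ?I) \<longlongrightarrow> (1 + 0) * ?I) (at_right 0)"
    by (intro tendsto_intros)
  ultimately show ?thesis
    using tendsto_lowerbound[of "\<lambda>t. (1 + t) * ?I" "(1 + 0) * ?I" "at_right 0"] by simp
qed

section \<open>Linearity of the transform and its behaviour under translation\<close>

lemma L2_space_integrable: "f \<in> L2_space A \<Longrightarrow> integrable (lebesgue_on A) (\<lambda>\<xi>. (norm (f \<xi>))\<^sup>2)"
  by (simp add: L2_space_def)

lemma has_fourier_transform_add:
  fixes Z Y :: "real \<Rightarrow> complex ^ 's"
  assumes L: "orthonormal_exponentials L A"
    and f: "has_fourier_transform L A Z f" and g: "has_fourier_transform L A Y g"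
  shows "has_fourier_transform L A (\<lambda>l. Z l + Y l) (\<lambda>\<xi>. f \<xi> + g \<xi>)"
proof -
  have f2: "f \<in> L2_space A" and g2: "g \<in> L2_space A"
    using f g by (auto simp: has_fourier_transform_iff)
  define D where "D Z f = (\<lambda>F. \<integral>\<xi>. (norm (f \<xi> - trig_poly Z F \<xi>))\<^sup>2 \<partial>lebesgue_on A)"
    for Z f :: "real \<Rightarrow> complex ^ 's"
  have "(D Z f \<longlongrightarrow> 0) (finite_subsets_at_top L)" "(D Y g \<longlongrightarrow> 0) (finite_subsets_at_top L)"
    using f g unfolding has_fourier_transform_iff D_def by auto
  then have lim: "((\<lambda>F. 2 * D Z f F + 2 * D Y g F) \<longlongrightarrow> 0) (finite_subsets_at_top L)"
    by (auto intro!: tendsto_eq_intros)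
  have "D (\<lambda>l. Z l + Y l) (\<lambda>\<xi>. f \<xi> + g \<xi>) F \<le> 2 * D Z f F + 2 * D Y g F"
    if F: "finite F" "F \<subseteq> L" for F
  proof -
    have ZF: "(\<lambda>\<xi>. f \<xi> - trig_poly Z F \<xi>) \<in> L2_space A"
      by (intro L2_space_diff f2 trig_poly_in_L2_space[OF L F])
    have YF: "(\<lambda>\<xi>. g \<xi> - trig_poly Y F \<xi>) \<in> L2_space A"
      by (intro L2_space_diff g2 trig_poly_in_L2_space[OF L F])
    have eq: "(f \<xi> + g \<xi>) - trig_poly (\<lambda>l. Z l + Y l) F \<xi>
        = (f \<xi> - trig_poly Z F \<xi>) + (g \<xi> - trig_poly Y F \<xi>)" for \<xi>
      by (simp add: trig_poly_def vector_add_ldistrib sum.distrib)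
    have "D (\<lambda>l. Z l + Y l) (\<lambda>\<xi>. f \<xi> + g \<xi>) F
        \<le> (\<integral>\<xi>. 2 * (norm (f \<xi> - trig_poly Z F \<xi>))\<^sup>2 + 2 * (norm (g \<xi> - trig_poly Y F \<xi>))\<^sup>2 \<partial>lebesgue_on A)"
      unfolding D_def eq
    proof (rule integral_mono)
      show "(norm ((f \<xi> - trig_poly Z F \<xi>) + (g \<xi> - trig_poly Y F \<xi>)))\<^sup>2
          \<le> 2 * (norm (f \<xi> - trig_poly Z F \<xi>))\<^sup>2 + 2 * (norm (g \<xi> - trig_poly Y F \<xi>))\<^sup>2" for \<xi>
        using norm_add_square_le[of 1] by simp
    qed (use L2_space_integrable[OF L2_space_add[OF ZF YF]]
        L2_space_integrable[OF ZF] L2_space_integrable[OF YF] in auto)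
    also have "\<dots> = 2 * D Z f F + 2 * D Y g F"
      using L2_space_integrable[OF ZF] L2_space_integrable[OF YF] by (simp add: D_def)
    finally show ?thesis .
  qed
  then have "(D (\<lambda>l. Z l + Y l) (\<lambda>\<xi>. f \<xi> + g \<xi>) \<longlongrightarrow> 0) (finite_subsets_at_top L)"
    by (intro tendsto_sandwich[OF _ _ tendsto_const lim] eventually_finite_subsets_at_top_weakI)
      (auto simp: D_def)
  then show ?thesis
    using L2_space_add[OF f2 g2] by (simp add: has_fourier_transform_iff D_def)
qed

lemma has_fourier_transform_scalar_mult:
  assumes f: "has_fourier_transform L A Z f"
  shows "has_fourier_transform L A (\<lambda>l. c *s Z l) (\<lambda>\<xi>. c *s f \<xi>)"
proof -
  have eq: "c *s f \<xi> - trig_poly (\<lambda>l. c *s Z l) F \<xi> = c *s (f \<xi> - trig_poly Z F \<xi>)" for F \<xi>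
    by (simp add: vec_eq_iff trig_poly_nth sum_distrib_left algebra_simps)
  have "(norm (c *s f \<xi> - trig_poly (\<lambda>l. c *s Z l) F \<xi>))\<^sup>2
      = (cmod c)\<^sup>2 * (norm (f \<xi> - trig_poly Z F \<xi>))\<^sup>2" for F \<xi>
    by (simp only: eq norm_vector_scalar_mult power_mult_distrib)
  moreover have "(\<lambda>\<xi>. c *s f \<xi>) \<in> L2_space A"
    using f by (intro L2_space_scalar_mult[of _ _ "cmod c"]) (auto simp: has_fourier_transform_iff)
  ultimately show ?thesis
    using f by (auto simp: has_fourier_transform_iff intro: tendsto_mult_right_zero)
qed

lemma has_fourier_transform_zero: "has_fourier_transform L A (\<lambda>l. 0) (\<lambda>\<xi>. 0)"
  by (simp add: has_fourier_transform_iff trig_poly_def L2_space_def)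

lemma has_fourier_transform_sum:
  assumes "orthonormal_exponentials L A" and "finite K"
    and "\<And>i. i \<in> K \<Longrightarrow> has_fourier_transform L A (Z i) (f i)"
  shows "has_fourier_transform L A (\<lambda>l. \<Sum>i\<in>K. Z i l) (\<lambda>\<xi>. \<Sum>i\<in>K. f i \<xi>)"
  using assms(2,3)
  by induction (simp_all add: has_fourier_transform_zero has_fourier_transform_add[OF assms(1)])

text \<open>Reindexing by \<open>l - a\<close> extracts the factor \<open>character a\<close>, whose
  modulus is 1, so the error over \<open>F\<close> equals the error of the original series over the
  shifted set.\<close>

lemma has_fourier_transform_translation:
  assumes f: "has_fourier_transform L A Z f" and a: "(\<lambda>x. x - a) ` L = L"
  shows "has_fourier_transform L A (translation a Z) (\<lambda>\<xi>. character a \<xi> *s f \<xi>)"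
proof -
  let ?D = "\<lambda>F. \<integral>\<xi>. (norm (f \<xi> - trig_poly Z F \<xi>))\<^sup>2 \<partial>lebesgue_on A"
  have "trig_poly (translation a Z) F \<xi> = character a \<xi> *s trig_poly Z ((\<lambda>x. x - a) ` F) \<xi>" for F \<xi>
  proof -
    have "character a \<xi> *s trig_poly Z ((\<lambda>x. x - a) ` F) \<xi>
        = (\<Sum>l\<in>F. (character a \<xi> * character (l - a) \<xi>) *s Z (l - a))"
      unfolding trig_poly_def
      by (subst sum.reindex) (auto simp: inj_on_def vec_eq_iff sum_distrib_left mult.assoc)
    then show ?thesis
      by (simp add: trig_poly_def translation_def flip: character_add)
  qed
  then have "norm (character a \<xi> *s f \<xi> - trig_poly (translation a Z) F \<xi>)
      = norm (character a \<xi> *s (f \<xi> - trig_poly Z ((\<lambda>x. x - a) ` F) \<xi>))" for F \<xi>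
    by (intro arg_cong[where f = norm]) (simp add: vec_eq_iff algebra_simps)
  then have eq: "norm (character a \<xi> *s f \<xi> - trig_poly (translation a Z) F \<xi>)
      = norm (f \<xi> - trig_poly Z ((\<lambda>x. x - a) ` F) \<xi>)" for F \<xi>
    by (simp only: norm_vector_scalar_mult norm_character mult_1)
  \<comment> \<open>Since the shift is a bijection of \<open>L\<close>, it carries the net of finite
    subsets of \<open>L\<close> to itself.\<close>
  have "filterlim ((`) (\<lambda>x. x - a)) (finite_subsets_at_top L) (finite_subsets_at_top L)"
    using filtermap_image_finite_subsets_at_top[of "\<lambda>x. x - a" L] a
    by (simp add: filterlim_def inj_on_def)
  moreover have "(?D \<longlongrightarrow> 0) (finite_subsets_at_top L)"
    using f by (simp add: has_fourier_transform_iff)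
  ultimately have "((\<lambda>F. ?D ((\<lambda>x. x - a) ` F)) \<longlongrightarrow> 0) (finite_subsets_at_top L)"
    by (rule filterlim_compose[rotated])
  moreover have "(\<lambda>\<xi>. character a \<xi> *s f \<xi>) \<in> L2_space A"
    using f by (intro L2_space_scalar_mult[of _ _ 1]) (auto simp: has_fourier_transform_iff)
  ultimately show ?thesis
    by (simp add: has_fourier_transform_iff eq)
qed

section \<open>Bessel bounds for translates\<close>

lemma synthesis_bound:
  fixes V :: "real \<Rightarrow> complex ^ 's" and s :: "'i \<Rightarrow> real"
  assumes L: "orthonormal_exponentials L A" and G: "has_fourier_transform L A V G"
    and B: "AE \<xi> in lebesgue_on A. norm (G \<xi>) \<le> B"
    and K: "finite K" "inj_on s K" "orthonormal_exponentials (s ` K) A"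
    and shift: "\<And>i. i \<in> K \<Longrightarrow> (\<lambda>x. x - s i) ` L = L"
    and F: "finite F" "F \<subseteq> L"
  shows "(\<Sum>l\<in>F. (norm (\<Sum>i\<in>K. c i *s translation (s i) V l))\<^sup>2) \<le> B\<^sup>2 * (\<Sum>i\<in>K. (cmod (c i))\<^sup>2)"
proof -
  let ?f = "\<lambda>\<xi>. \<Sum>i\<in>K. c i *s (character (s i) \<xi> *s G \<xi>)"
  \<comment> \<open>The multiplier is indexed by its frequencies, the form
    \<open>pythagoras_scalar\<close> expects; \<open>inv_into\<close> recovers the index carrying
    the coefficient.\<close>
  let ?p = "\<lambda>\<xi>. \<Sum>a\<in>s ` K. character a \<xi> * c (inv_into K s a)"
  have f: "has_fourier_transform L A (\<lambda>l. \<Sum>i\<in>K. c i *s translation (s i) V l) ?f"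
    by (intro has_fourier_transform_sum[OF L] has_fourier_transform_scalar_mult
        has_fourier_transform_translation G K shift)
  have "?f \<xi> = ?p \<xi> *s G \<xi>" for \<xi>
    using K by (simp add: sum.reindex vec_eq_iff sum_distrib_left mult_ac)
  then have le: "(norm (?f \<xi>))\<^sup>2 \<le> B\<^sup>2 * (cmod (?p \<xi>))\<^sup>2" if "norm (G \<xi>) \<le> B" for \<xi>
    using that
    by (simp add: norm_vector_scalar_mult power_mult_distrib mult.commute mult_right_mono power_mono)
  have "(\<Sum>l\<in>F. (norm (\<Sum>i\<in>K. c i *s translation (s i) V l))\<^sup>2) \<le> (\<integral>\<xi>. (norm (?f \<xi>))\<^sup>2 \<partial>lebesgue_on A)"
    by (rule bessel_fourier_transform[OF L f F])
  also have "\<dots> \<le> (\<integral>\<xi>. B\<^sup>2 * (cmod (?p \<xi>))\<^sup>2 \<partial>lebesgue_on A)"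
  proof (rule integral_mono_AE)
    show "AE \<xi> in lebesgue_on A. (norm (?f \<xi>))\<^sup>2 \<le> B\<^sup>2 * (cmod (?p \<xi>))\<^sup>2"
      using B by eventually_elim (rule le)
  qed (use f pythagoras_scalar(1)[OF K(3)] K in \<open>auto simp: has_fourier_transform_iff L2_space_def\<close>)
  also have "\<dots> = B\<^sup>2 * (\<Sum>a\<in>s ` K. (cmod (c (inv_into K s a)))\<^sup>2)"
    using pythagoras_scalar(2)[OF K(3)] K(1) by simp
  also have "\<dots> = B\<^sup>2 * (\<Sum>i\<in>K. (cmod (c i))\<^sup>2)"
    using K by (simp add: sum.reindex)
  finally show ?thesis .
qed

text \<open>Weighted AM-GM takes the place of Cauchy-Schwarz. The weight \<open>t = 1\<close> gives
  summability of inner products, and \<open>t = B^2\<close> balances the two terms in the duality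
  argument.\<close>

lemma cmod_vec_inner_le:
  fixes v w :: "complex ^ 's"
  assumes "t > 0"
  shows "cmod (\<Sum>k\<in>UNIV. v $ k * cnj (w $ k)) \<le> t / 2 * (norm v)\<^sup>2 + 1 / (2 * t) * (norm w)\<^sup>2"
proof -
  have amgm: "x * y \<le> t / 2 * x\<^sup>2 + 1 / (2 * t) * y\<^sup>2" for x y :: real
  proof -
    have "0 \<le> (t * x - y)\<^sup>2 / t" using assms by simp
    then show ?thesis using assms by (simp add: power2_eq_square field_simps)
  qed
  have "cmod (\<Sum>k\<in>UNIV. v $ k * cnj (w $ k)) \<le> (\<Sum>k\<in>UNIV. cmod (v $ k) * cmod (w $ k))"
    by (rule order_trans[OF norm_sum]) (simp add: norm_mult)
  also have "\<dots> \<le> (\<Sum>k\<in>UNIV. t / 2 * (cmod (v $ k))\<^sup>2 + 1 / (2 * t) * (cmod (w $ k))\<^sup>2)"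
    by (intro sum_mono amgm)
  also have "\<dots> = t / 2 * (norm v)\<^sup>2 + 1 / (2 * t) * (norm w)\<^sup>2"
    by (simp only: norm_vec_square sum.distrib sum_distrib_left)
  finally show ?thesis .
qed

section \<open>Inner product and norm on \<open>ell2\<close>\<close>

lemma summable_vec_inner:
  assumes "Z \<in> ell2 L" "Y \<in> ell2 L"
  shows "(\<lambda>l. \<Sum>k\<in>UNIV. Z l $ k * cnj (Y l $ k)) summable_on L"
proof (rule abs_summable_summable, rule summable_on_comparison_test)
  show "(\<lambda>l. 1 / 2 * (norm (Z l))\<^sup>2 + 1 / (2 * 1) * (norm (Y l))\<^sup>2) summable_on L"
    using assms unfolding ell2_iff by (intro summable_on_add summable_on_cmult_right)
qed (use cmod_vec_inner_le[of 1] in auto)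

lemma ell2_norm_square:
  assumes "Z \<in> ell2 L"
  shows "(ell2_norm L Z)\<^sup>2 = (\<Sum>\<^sub>\<infinity>l\<in>L. (norm (Z l))\<^sup>2)"
proof -
  have "ell2_inner L Z Z = (\<Sum>\<^sub>\<infinity>l\<in>L. complex_of_real ((norm (Z l))\<^sup>2))"
    unfolding ell2_inner_def norm_vec_square by (simp add: complex_norm_square del: of_real_power)
  also have "\<dots> = complex_of_real (\<Sum>\<^sub>\<infinity>l\<in>L. (norm (Z l))\<^sup>2)"
    using assms unfolding ell2_iff by (intro infsumI has_sum_of_real has_sum_infsum)
  finally have "Re (ell2_inner L Z Z) = (\<Sum>\<^sub>\<infinity>l\<in>L. (norm (Z l))\<^sup>2)"
    by simp
  then show ?thesis
    unfolding ell2_norm_def by (simp add: infsum_nonneg)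
qed

lemma ell2_inner_scalar_mult_right: "ell2_inner L Z (\<lambda>l. c *s Y l) = cnj c * ell2_inner L Z Y"
proof -
  have "(\<Sum>k\<in>UNIV. Z l $ k * cnj ((c *s Y l) $ k)) = cnj c * (\<Sum>k\<in>UNIV. Z l $ k * cnj (Y l $ k))" for l
    by (simp add: sum_distrib_left mult_ac)
  then show ?thesis
    unfolding ell2_inner_def by (simp add: infsum_cmult_right')
qed

lemma translation_in_ell2:
  assumes "V \<in> ell2 L" and a: "(\<lambda>x. x - a) ` L = L"
  shows "translation a V \<in> ell2 L"
proof -
  have "((\<lambda>l. (norm (V l))\<^sup>2) \<circ> (\<lambda>x. x - a)) summable_on L"
    using assms by (subst summable_on_reindex[symmetric]) (auto simp: ell2_iff inj_on_def)
  then show ?thesis by (simp add: ell2_iff translation_def o_def)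
qed

lemma has_sum_finite_sum:
  fixes f :: "'i \<Rightarrow> 'a \<Rightarrow> 'b::topological_comm_monoid_add"
  assumes "finite K" and "\<And>i. i \<in> K \<Longrightarrow> (f i has_sum S i) A"
  shows "((\<lambda>x. \<Sum>i\<in>K. f i x) has_sum (\<Sum>i\<in>K. S i)) A"
  using assms by induction (auto intro: has_sum_add)

text \<open>
  Duality: with \<open>c\<^sub>i = \<langle>Z, g\<^sub>i\<rangle>\<close>, \<open>S = \<Sum> |c\<^sub>i|\<^sup>2\<close> and \<open>Y = \<Sum> c\<^sub>i g\<^sub>i\<close> one has
  \<open>S = \<langle>Z, Y\<rangle> \<le> (B\<^sup>2 \<parallel>Z\<parallel>\<^sup>2 + \<parallel>Y\<parallel>\<^sup>2 / B\<^sup>2) / 2 \<le> (B\<^sup>2 \<parallel>Z\<parallel>\<^sup>2 + S) / 2\<close>.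
\<close>

lemma bessel_translations:
  fixes V Z :: "real \<Rightarrow> complex ^ 's" and s :: "'i \<Rightarrow> real"
  assumes L: "orthonormal_exponentials L A" and G: "has_fourier_transform L A V G"
    and B: "AE \<xi> in lebesgue_on A. norm (G \<xi>) \<le> B" "B > 0"
    and K: "finite K" "inj_on s K" "orthonormal_exponentials (s ` K) A"
    and shift: "\<And>i. i \<in> K \<Longrightarrow> (\<lambda>x. x - s i) ` L = L"
    and V: "V \<in> ell2 L" and Z: "Z \<in> ell2 L"
  shows "(\<Sum>i\<in>K. (cmod (ell2_inner L Z (translation (s i) V)))\<^sup>2) \<le> B\<^sup>2 * (ell2_norm L Z)\<^sup>2"
proof -
  define c where "c i = ell2_inner L Z (translation (s i) V)" for i
  define S where "S = (\<Sum>i\<in>K. (cmod (c i))\<^sup>2)"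
  define Y where "Y l = (\<Sum>i\<in>K. c i *s translation (s i) V l)" for l
  have Ybd: "(\<Sum>l\<in>F. (norm (Y l))\<^sup>2) \<le> B\<^sup>2 * S" if "finite F" "F \<subseteq> L" for F
    unfolding Y_def S_def by (rule synthesis_bound[OF L G B(1) K shift that])
  \<comment> \<open>The uniform bound on finite sums yields first the summability of
    \<open>Y\<close> and then the bound on its norm.\<close>
  have Ysum: "(\<lambda>l. (norm (Y l))\<^sup>2) summable_on L"
    using Ybd by (intro nonneg_bdd_above_summable_on) (auto intro!: bdd_aboveI2)
  have Yle: "(\<Sum>\<^sub>\<infinity>l\<in>L. (norm (Y l))\<^sup>2) \<le> B\<^sup>2 * S"
    using Ysum Ybd by (rule infsum_le_finite_sums)
  have Zsum: "(\<lambda>l. (norm (Z l))\<^sup>2) summable_on L"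
    using Z by (simp add: ell2_iff)
  \<comment> \<open>Summing these over \<open>i\<close> expands the inner product of
    \<open>Z\<close> and \<open>Y\<close>, whose value is \<open>S\<close>.\<close>
  have "((\<lambda>l. cnj (c i) * (\<Sum>k\<in>UNIV. Z l $ k * cnj (translation (s i) V l $ k)))
      has_sum cnj (c i) * c i) L" if "i \<in> K" for i
    unfolding c_def[of i] ell2_inner_def
    by (intro has_sum_cmult_right has_sum_infsum summable_vec_inner Z translation_in_ell2 V shift that)
  then have "((\<lambda>l. \<Sum>i\<in>K. cnj (c i) * (\<Sum>k\<in>UNIV. Z l $ k * cnj (translation (s i) V l $ k)))
      has_sum (\<Sum>i\<in>K. cnj (c i) * c i)) L"
    by (rule has_sum_finite_sum[OF K(1)])
  also have "(\<lambda>l. \<Sum>i\<in>K. cnj (c i) * (\<Sum>k\<in>UNIV. Z l $ k * cnj (translation (s i) V l $ k)))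
      = (\<lambda>l. \<Sum>k\<in>UNIV. Z l $ k * cnj (Y l $ k))"
    by (intro ext) (simp add: Y_def sum_distrib_left mult_ac, rule sum.swap)
  also have "(\<Sum>i\<in>K. cnj (c i) * c i) = complex_of_real S"
    by (simp add: S_def complex_norm_square mult.commute del: of_real_power)
  finally have "norm (complex_of_real S)
      \<le> B\<^sup>2 / 2 * (\<Sum>\<^sub>\<infinity>l\<in>L. (norm (Z l))\<^sup>2) + 1 / (2 * B\<^sup>2) * (\<Sum>\<^sub>\<infinity>l\<in>L. (norm (Y l))\<^sup>2)"
  proof (rule norm_infsum_le)
    show "((\<lambda>l. B\<^sup>2 / 2 * (norm (Z l))\<^sup>2 + 1 / (2 * B\<^sup>2) * (norm (Y l))\<^sup>2) has_sum
        B\<^sup>2 / 2 * (\<Sum>\<^sub>\<infinity>l\<in>L. (norm (Z l))\<^sup>2) + 1 / (2 * B\<^sup>2) * (\<Sum>\<^sub>\<infinity>l\<in>L. (norm (Y l))\<^sup>2)) L"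
      by (intro has_sum_add has_sum_cmult_right has_sum_infsum Zsum Ysum)
    show "cmod (\<Sum>k\<in>UNIV. Z l $ k * cnj (Y l $ k))
        \<le> B\<^sup>2 / 2 * (norm (Z l))\<^sup>2 + 1 / (2 * B\<^sup>2) * (norm (Y l))\<^sup>2" for l
      using B(2) by (intro cmod_vec_inner_le) simp
  qed
  also have "\<dots> \<le> (B\<^sup>2 * (\<Sum>\<^sub>\<infinity>l\<in>L. (norm (Z l))\<^sup>2) + S) / 2"
    using Yle B(2) by (simp add: field_simps)
  finally have "S \<le> B\<^sup>2 * (\<Sum>\<^sub>\<infinity>l\<in>L. (norm (Z l))\<^sup>2)"
    by (simp add: norm_of_real)
  then show ?thesis
    by (simp add: S_def c_def ell2_norm_square[OF Z])
qed

section \<open>Frequencies of the Gabor system\<close>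

lemma character_half_even: "character (2 * of_int n) (1/2) = 1"
  using cis_multiple_2pi[of "of_int n"] by (simp add: character_eq_cis mult.assoc)

lemma character_odd:
  assumes "odd n" and "a * b = of_int n"
  shows "character a (b / 2) = - 1"
proof -
  obtain m where "n = 2 * m + 1" using assms(1) by (rule oddE)
  then have "pi * (a * b) = 2 * pi * of_int m + pi"
    unfolding assms(2) by (simp add: distrib_left)
  moreover have "character a (b / 2) = cis (pi * (a * b))"
    by (simp add: character_eq_cis mult.assoc)
  moreover have "cis (2 * pi * of_int m + pi) = - 1"
    using cis_multiple_2pi[of "of_int m"] unfolding cis_mult[symmetric] by simp
  ultimately show ?thesis by simp
qed

text \<open>The diagonal entries are 1 because the domain has total length 1. Off the diagonal, the
  first alternative says that \<open>a - b\<close> is an even integer, the second that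
  \<open>(a - b) * N\<close> is an odd integer.\<close>

lemma orthonormal_exponentials_Omega:
  assumes N: "N \<ge> 1"
    and diff: "\<And>a b. a \<in> L \<Longrightarrow> b \<in> L \<Longrightarrow> a \<noteq> b \<Longrightarrow>
      character (a - b) (1/2) = 1 \<or> character (a - b) (real N / 2) = - 1"
  shows "orthonormal_exponentials L (Omega_set N)"
proof -
  have disj: "{0..<1/2} \<inter> {real N / 2..<(real N + 1) / 2} = {}"
    using N by auto
  have lm: "{0..<1/2::real} \<in> lmeasurable" "{real N / 2..<(real N + 1) / 2} \<in> lmeasurable"
    by (auto intro: bounded_set_imp_lmeasurable)
  then have Omega: "Omega_set N \<in> lmeasurable"
    unfolding Omega_set_def by (rule fmeasurable.Un)
  have length: "measure lebesgue {a..<b} = b - a" if "a \<le> b" for a b :: real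
    using that by (simp add: measure_def)
  have "measure lebesgue (Omega_set N) = measure lebesgue {0..<1/2::real} + measure lebesgue {real N / 2..<(real N + 1) / 2}"
    using measure_Un2[OF lm] disj unfolding Omega_set_def
    by (simp add: Diff_triv Int_commute)
  also have "\<dots> = 1"
    using length[of 0 "1/2"] length[of "real N / 2" "(real N + 1) / 2"] by (simp add: add_divide_distrib)
  finally have "measure lebesgue (Omega_set N) = 1" .
  then have one: "(\<integral>\<xi>. character 0 \<xi> \<partial>lebesgue_on (Omega_set N)) = 1"
    using Omega by (simp add: measure_restrict_space fmeasurableD)
  have "(\<integral>\<xi>. character (a - b) \<xi> \<partial>lebesgue_on (Omega_set N)) = of_bool (a = b)"
    if "a \<in> L" "b \<in> L" for a b
  proof (cases "a = b")
    case True
    then show ?thesis by (simp only: diff_self one of_bool_eq simp_thms)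
  next
    case False
    then have "a - b \<noteq> 0" by simp
    from integral_character_Omega[OF this diff[OF that False] N] False show ?thesis
      by simp
  qed
  then show ?thesis
    using Omega unfolding orthonormal_exponentials_def by blast
qed

lemma orthonormal_even:
  assumes "N \<ge> 1" and "\<And>a. a \<in> L \<Longrightarrow> \<exists>n. a = 2 * of_int n"
  shows "orthonormal_exponentials L (Omega_set N)"
proof (rule orthonormal_exponentials_Omega[OF assms(1)])
  fix a b assume "a \<in> L" "b \<in> L"
  then obtain m n where "a = 2 * of_int m" "b = 2 * of_int n" using assms(2) by metis
  then have "a - b = 2 * of_int (m - n)" by simp
  then show "character (a - b) (1/2) = 1 \<or> character (a - b) (real N / 2) = - 1"
    by (metis character_half_even)
qed

text \<open>Frequencies in the same coset of the even integers differ by an even integer. For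
  different cosets, \<open>N\<close> times the difference is \<open>r\<close> or \<open>- r\<close>
  plus an even integer, hence odd.\<close>

lemma orthonormal_spec_set:
  assumes N: "N \<ge> 1" and r: "odd r"
  shows "orthonormal_exponentials (spec_set N r) (Omega_set N)"
proof (rule orthonormal_exponentials_Omega[OF N])
  fix a b assume "a \<in> spec_set N r" "b \<in> spec_set N r"
  then obtain x y m n where ab: "a = x + 2 * of_int m" "b = y + 2 * of_int n"
    and xy: "x \<in> {0, real r / real N}" "y \<in> {0, real r / real N}"
    unfolding spec_set_def by blast
  show "character (a - b) (1/2) = 1 \<or> character (a - b) (real N / 2) = - 1"
  proof (cases "x = y")
    case True
    then have "a - b = 2 * of_int (m - n)" using ab by simp
    then show ?thesis by (metis character_half_even)
  next
    case False
    then have "(x - y) * real N = real r \<or> (x - y) * real N = - real r"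
      using xy N by auto
    moreover have "(a - b) * real N = (x - y) * real N + 2 * of_int (m - n) * real N"
      using ab by (simp add: algebra_simps)
    ultimately have "(a - b) * real N = of_int (int r + 2 * (m - n) * int N) \<or>
        (a - b) * real N = of_int (- int r + 2 * (m - n) * int N)"
      by auto
    then show ?thesis
      using r character_odd by (metis dvd_add_left_iff dvd_triv_left even_minus even_of_nat mult.assoc)
  qed
qed

text \<open>The factor \<open>N\<close> clears the denominator in \<open>r / N\<close>. Evenness
  makes the translations preserve the spectrum and makes the corresponding exponentials
  orthonormal.\<close>

lemma spec_set_shift_even:
  assumes "N \<ge> 1" and "l \<in> spec_set N r"
  obtains k where "2 * real N * l = 2 * of_int k"
proof -
  obtain x n where l: "l = x + 2 * of_int n" "x \<in> {0, real r / real N}"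
    using assms(2) unfolding spec_set_def by blast
  then have "2 * real N * l = 2 * of_int (2 * int N * n) \<or> 2 * real N * l = 2 * of_int (int r + 2 * int N * n)"
    using assms(1) by (auto simp: field_simps)
  then show thesis using that by blast
qed

lemma spec_set_translate:
  "(\<lambda>x. x - 2 * of_int k) ` spec_set N r = spec_set N r"
proof -
  \<comment> \<open>The inclusion is stated for every \<open>k\<close>, since the converse inclusion
    is its instance at \<open>- k\<close>.\<close>
  have sub: "(\<lambda>x. x - 2 * of_int k) ` spec_set N r \<subseteq> spec_set N r" for k
  proof (rule image_subsetI)
    fix y assume "y \<in> spec_set N r"
    then obtain x n where x: "x \<in> {0, real r / real N}" and "y = x + 2 * of_int n"
      unfolding spec_set_def by blast
    then have "y - 2 * of_int k = x + 2 * of_int (n - k)"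
      by simp
    with x show "y - 2 * of_int k \<in> spec_set N r"
      unfolding spec_set_def by blast
  qed
  show ?thesis
  proof
    show "spec_set N r \<subseteq> (\<lambda>x. x - 2 * of_int k) ` spec_set N r"
    proof
      fix y assume "y \<in> spec_set N r"
      then have "y + 2 * of_int k \<in> spec_set N r" using sub[of "- k"] by auto
      then show "y \<in> (\<lambda>x. x - 2 * of_int k) ` spec_set N r" by force
    qed
  qed (rule sub)
qed

text \<open>Modulation and translation commute up to a constant of modulus 1, which disappears from
  the modulus of an inner product. The system can thus be treated as translates of the modulated
  windows, to which the Fourier bound applies.\<close>

lemma gabor_system_eq:
  fixes W :: "nat \<Rightarrow> real \<Rightarrow> complex ^ 's"
  shows "gabor_system N M W (m, j, l) = (\<lambda>x. character (real m / real M) (2 * real N * l) *s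
     translation (2 * real N * l) (modulation (real m / real M) (W j)) x)"
proof -
  have "modulation b V = (\<lambda>x. character b x *s V x)" for b and V :: "real \<Rightarrow> complex ^ 's"
    by (simp add: modulation_def character_def)
  then show ?thesis
    by (simp add: gabor_system_def translation_def vector_smult_assoc flip: character_add_right)
qed

lemma modulation_in_ell2: "Z \<in> ell2 L \<Longrightarrow> modulation b Z \<in> ell2 L"
  by (simp add: ell2_iff modulation_def norm_vector_scalar_mult)

section \<open>Summing the bounds over modulations and windows\<close>

theorem theorem3p3:
  fixes N M P r :: nat
    and W :: "nat \<Rightarrow> real \<Rightarrow> complex ^ 's"
    and B\<^sub>0 :: real
  assumes "N \<ge> 1" and "M \<ge> 1"
    and "odd r" and "coprime r N" and "1 \<le> r" and "r \<le> 2 * N - 1"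
    and "\<And>j. j \<in> {0..P} \<Longrightarrow> W j \<in> ell2 (spec_set N r)"
    and "B\<^sub>0 > 0"
    and "\<And>m j. m \<in> {0..<M} \<Longrightarrow> j \<in> {0..P} \<Longrightarrow>
           AE \<xi> in lebesgue_on (Omega_set N).
             norm (fourier_transform (spec_set N r) (Omega_set N)
                     (modulation (real m / real M) (W j)) \<xi>) \<le> B\<^sub>0"
  shows "DVNUG_Bessel_sequence N r M P W (2 ^ (M + P) * B\<^sub>0\<^sup>2 * real CARD('s))"
proof -
  let ?L = "spec_set N r" and ?I = "{0..<M} \<times> {0..P} \<times> spec_set N r"
  let ?\<beta> = "2 ^ (M + P) * B\<^sub>0\<^sup>2 * real CARD('s)"
  have L: "orthonormal_exponentials ?L (Omega_set N)"
    using assms(1,3) by (rule orthonormal_spec_set)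
  have single: "(\<Sum>l\<in>K. (cmod (ell2_inner ?L Z (gabor_system N M W (m, j, l))))\<^sup>2)
      \<le> B\<^sub>0\<^sup>2 * (ell2_norm ?L Z)\<^sup>2"
    if Z: "Z \<in> ell2 ?L" and m: "m \<in> {0..<M}" and j: "j \<in> {0..P}" and K: "finite K" "K \<subseteq> ?L"
    for Z m j K
  proof -
    let ?V = "modulation (real m / real M) (W j)"
    have V: "?V \<in> ell2 ?L" using assms(7)[OF j] by (rule modulation_in_ell2)
    \<comment> \<open>Existence guarantees that the choice in \<open>fourier_transform\<close> picks
      a genuine transform.\<close>
    have G: "has_fourier_transform ?L (Omega_set N) ?V (fourier_transform ?L (Omega_set N) ?V)"
      unfolding fourier_transform_def by (rule someI_ex[OF has_fourier_transform_exists[OF L V]])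
    have "(\<Sum>l\<in>K. (cmod (ell2_inner ?L Z (translation (2 * real N * l) ?V)))\<^sup>2)
        \<le> B\<^sub>0\<^sup>2 * (ell2_norm ?L Z)\<^sup>2"
    proof (rule bessel_translations[OF L G assms(9)[OF m j] assms(8) K(1) _ _ _ V Z])
      show "inj_on (\<lambda>l. 2 * real N * l) K"
        using assms(1) by (auto simp: inj_on_def)
      show "orthonormal_exponentials ((\<lambda>l. 2 * real N * l) ` K) (Omega_set N)"
        using K(2) spec_set_shift_even[OF assms(1)] by (intro orthonormal_even[OF assms(1)]) blast
      show "(\<lambda>x. x - 2 * real N * l) ` ?L = ?L" if "l \<in> K" for l
        using K(2) that spec_set_shift_even[OF assms(1), of l] spec_set_translate by (metis subsetD)
    qed
    then show ?thesis
      by (simp add: gabor_system_eq ell2_inner_scalar_mult_right norm_mult)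
  qed
  have finite_bound: "(\<Sum>i\<in>F. (cmod (ell2_inner ?L Z (gabor_system N M W i)))\<^sup>2) \<le> ?\<beta> * (ell2_norm ?L Z)\<^sup>2"
    if Z: "Z \<in> ell2 ?L" and F: "finite F" "F \<subseteq> ?I" for Z F
  proof -
    \<comment> \<open>\<open>K\<close> collects the translation parameters occurring in
      \<open>F\<close>, so that \<open>F\<close> lies in a finite box over which the sum splits into
      the single bounds.\<close>
    define K where "K = (snd \<circ> snd) ` F"
    have K: "finite K" "K \<subseteq> ?L" using F by (auto simp: K_def)
    have "F \<subseteq> {0..<M} \<times> {0..P} \<times> K" using F by (force simp: K_def)
    then have "(\<Sum>i\<in>F. (cmod (ell2_inner ?L Z (gabor_system N M W i)))\<^sup>2)
        \<le> (\<Sum>i\<in>{0..<M} \<times> {0..P} \<times> K. (cmod (ell2_inner ?L Z (gabor_system N M W i)))\<^sup>2)"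
      using K by (intro sum_mono2) auto
    also have "\<dots> = (\<Sum>m\<in>{0..<M}. \<Sum>j\<in>{0..P}. \<Sum>l\<in>K.
        (cmod (ell2_inner ?L Z (gabor_system N M W (m, j, l))))\<^sup>2)"
      by (simp add: sum.cartesian_product)
    also have "\<dots> \<le> (\<Sum>m\<in>{0..<M}. \<Sum>j\<in>{0..P}. B\<^sub>0\<^sup>2 * (ell2_norm ?L Z)\<^sup>2)"
      by (intro sum_mono single Z K)
    \<comment> \<open>The factor 1 is a placeholder, to be bounded by the dimension
      \<open>CARD('s)\<close>.\<close>
    also have "\<dots> = real (M * (P + 1)) * 1 * (B\<^sub>0\<^sup>2 * (ell2_norm ?L Z)\<^sup>2)"
      by (simp add: algebra_simps)
    also have "\<dots> \<le> 2 ^ (M + P) * real CARD('s) * (B\<^sub>0\<^sup>2 * (ell2_norm ?L Z)\<^sup>2)"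
    proof (intro mult_right_mono mult_mono)
      \<comment> \<open>Strictness of \<open>P < 2 ^ P\<close> absorbs the extra 1 in
        \<open>P + 1\<close>, the number of windows.\<close>
      have "M * (P + 1) \<le> 2 ^ (M + P)"
        unfolding power_add using less_exp[of M] less_exp[of P]
        by (intro mult_mono) (auto simp: Suc_le_eq)
      then show "real (M * (P + 1)) \<le> 2 ^ (M + P)"
        by (metis of_nat_le_iff of_nat_numeral of_nat_power)
      show "1 \<le> real CARD('s)"
        by (simp add: Suc_le_eq)
    qed auto
    finally show ?thesis by (simp add: mult_ac)
  qed
  have "(\<lambda>i. (cmod (ell2_inner ?L Z (gabor_system N M W i)))\<^sup>2) summable_on ?I"
    if "Z \<in> ell2 ?L" for Z
    using finite_bound[OF that] by (intro nonneg_bdd_above_summable_on) (auto intro!: bdd_aboveI2)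
  then show ?thesis
    unfolding DVNUG_Bessel_sequence_def Bessel_sequence_def
    using assms(8) finite_bound by (auto intro!: infsum_le_finite_sums)
qed

end
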